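(* Let $\beta_0,\beta_1\in(1,2]$, $x\in[0,\frac{1}{\beta_1-1}]$ and let $w\in\{0,1\}^{\mathbb{N}}$ be a $(\beta_0,\beta_1)$-expansion of $x$. Then (with $n$ ranging over $\mathbb{N}$): (1) $w$ is the greedy expansion of $x$ if and only if $\sigma^nw\prec g^*\big(\frac{\beta_0}{\beta_1}\big)$ whenever $w_n=0$; (2) $w$ is the lazy expansion of $x$ if and only if $\sigma^nw\succ l^*\big(\frac{\beta_1}{\beta_0(\beta_1-1)}-1\big)$ whenever $w_n=1$; (3) $w$ is the unique expansion of $x$ if and only if $\sigma^nw\prec g^*\big(\frac{\beta_0}{\beta_1}\big)$ whenever $w_n=0$ and $\sigma^nw\succ l^*\big(\frac{\beta_1}{\beta_0(\beta_1-1)}-1\big)$ whenever $w_n=1$.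
   Context: $\mathbb{N}=\{1,2,3,\dots\}$. For $\beta_0,\beta_1\in(1,2]$ let $T_0(x)=\beta_0x$, $T_1(x)=\beta_1x-1$, $a_1=\frac1{\beta_1}$, $b_0=\frac{1}{\beta_0(\beta_1-1)}$, $b_1=\frac{1}{\beta_1-1}$; one has $0<a_1\le b_0<b_1$. A sequence $w\in\{0,1\}^{\mathbb{N}}$ is a $(\beta_0,\beta_1)$-expansion of $x$ if $x=\sum_{i=1}^\infty\frac{w_i}{\beta_{w_1}\cdots\beta_{w_i}}$; it is the unique expansion of $x$ if it is the only $(\beta_0,\beta_1)$-expansion of $x$. The shift is $\sigma(w_1w_2\cdots)=w_2w_3\cdots$, and $\prec,\succ$ denote strict lexicographic order. Define self-maps of $[0,b_1]$ by applying $T_0$ on piece $0$ and $T_1$ on piece $1$ of the following partitions: - greedy $G$: $[0,a_1)$ and $[a_1,b_1]$; - quasi-greedy $G^*$: $[0,a_1]$ and $(a_1,b_1]$; - lazy $L$: $[0,b_0]$ and $(b_0,b_1]$; - quasi-lazy $L^*$: $[0,b_0)$ and $[b_0,b_1]$. For $x\in[0,b_1]$ the greedy expansion $g(x)=(g_n(x))_{n\ge1}$ has $g_n(x)=k$ where $G^{n-1}x$ lies in piece $k$ for $G$; the quasi-greedy expansion $g^*(x)$, lazy expansion $l(x)$ and quasi-lazy expansion $l^*(x)$ are defined in the same way from $G^*$, $L$, $L^*$. *)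

theory Defs
  imports "HOL-Analysis.Analysis" "HOL-Library.Fun_Lexorder"
begin

(* A sequence w_1 w_2 ... in {0,1}^N is a function w :: nat => nat with range
   in {0,1} and positions shifted by one: w i is the digit w_(i+1). *)

definition base :: "real \<Rightarrow> real \<Rightarrow> nat \<Rightarrow> real" where
  "base \<beta>\<^sub>0 \<beta>\<^sub>1 k = (if k = 0 then \<beta>\<^sub>0 else \<beta>\<^sub>1)"

definition is_expansion :: "real \<Rightarrow> real \<Rightarrow> real \<Rightarrow> (nat \<Rightarrow> nat) \<Rightarrow> bool" where
  "is_expansion \<beta>\<^sub>0 \<beta>\<^sub>1 x w \<longleftrightarrow>
     range w \<subseteq> {0, 1} \<and>
     (\<lambda>i. real (w i) / (\<Prod>j\<le>i. base \<beta>\<^sub>0 \<beta>\<^sub>1 (w j))) sums x"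

definition is_unique_expansion :: "real \<Rightarrow> real \<Rightarrow> real \<Rightarrow> (nat \<Rightarrow> nat) \<Rightarrow> bool" where
  "is_unique_expansion \<beta>\<^sub>0 \<beta>\<^sub>1 x w \<longleftrightarrow>
     is_expansion \<beta>\<^sub>0 \<beta>\<^sub>1 x w \<and> (\<forall>v. is_expansion \<beta>\<^sub>0 \<beta>\<^sub>1 x v \<longrightarrow> v = w)"

definition shift :: "(nat \<Rightarrow> nat) \<Rightarrow> nat \<Rightarrow> nat" where
  "shift w = (\<lambda>i. w (Suc i))"

definition T0 :: "real \<Rightarrow> real \<Rightarrow> real" where
  "T0 \<beta>\<^sub>0 x = \<beta>\<^sub>0 * x"

definition T1 :: "real \<Rightarrow> real \<Rightarrow> real" where
  "T1 \<beta>\<^sub>1 x = \<beta>\<^sub>1 * x - 1"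

(* A partition of [0, 1/(\<beta>\<^sub>1 - 1)] is given by its piece 0, a set P; piece 1 is
   the rest of that interval.  Values outside the interval are irrelevant, as
   each of the four maps below sends it into itself. *)

definition piece_map :: "real \<Rightarrow> real \<Rightarrow> real set \<Rightarrow> real \<Rightarrow> real" where
  "piece_map \<beta>\<^sub>0 \<beta>\<^sub>1 P x = (if x \<in> P then T0 \<beta>\<^sub>0 x else T1 \<beta>\<^sub>1 x)"

definition piece_digits :: "real \<Rightarrow> real \<Rightarrow> real set \<Rightarrow> real \<Rightarrow> nat \<Rightarrow> nat" where
  "piece_digits \<beta>\<^sub>0 \<beta>\<^sub>1 P x n = (if (piece_map \<beta>\<^sub>0 \<beta>\<^sub>1 P ^^ n) x \<in> P then 0 else 1)"

definition greedy_expansion :: "real \<Rightarrow> real \<Rightarrow> real \<Rightarrow> nat \<Rightarrow> nat" where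
  "greedy_expansion \<beta>\<^sub>0 \<beta>\<^sub>1 = piece_digits \<beta>\<^sub>0 \<beta>\<^sub>1 {0..<1 / \<beta>\<^sub>1}"

definition quasi_greedy_expansion :: "real \<Rightarrow> real \<Rightarrow> real \<Rightarrow> nat \<Rightarrow> nat" where
  "quasi_greedy_expansion \<beta>\<^sub>0 \<beta>\<^sub>1 = piece_digits \<beta>\<^sub>0 \<beta>\<^sub>1 {0..1 / \<beta>\<^sub>1}"

definition lazy_expansion :: "real \<Rightarrow> real \<Rightarrow> real \<Rightarrow> nat \<Rightarrow> nat" where
  "lazy_expansion \<beta>\<^sub>0 \<beta>\<^sub>1 = piece_digits \<beta>\<^sub>0 \<beta>\<^sub>1 {0..1 / (\<beta>\<^sub>0 * (\<beta>\<^sub>1 - 1))}"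

definition quasi_lazy_expansion :: "real \<Rightarrow> real \<Rightarrow> real \<Rightarrow> nat \<Rightarrow> nat" where
  "quasi_lazy_expansion \<beta>\<^sub>0 \<beta>\<^sub>1 = piece_digits \<beta>\<^sub>0 \<beta>\<^sub>1 {0..<1 / (\<beta>\<^sub>0 * (\<beta>\<^sub>1 - 1))}"

end

theory Submission
  imports Defs
begin

text \<open>
  Reading off the digits of an expansion \<open>w\<close> of \<open>x\<close> one after the other produces the orbit
  \<open>X n = \<pi>(\<sigma>\<^sup>n w)\<close>, where \<open>\<pi>\<close> is the value of a digit sequence; it obeys
  \<open>X (n + 1) = T\<^sub>d (X n)\<close> with \<open>d = w n\<close>.  Because both maps expand, the expansions of \<open>x\<close> are
  exactly the digit sequences whose orbit from \<open>x\<close> stays in \<open>[0, b\<^sub>1]\<close>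
  (\<open>expansion_if_orbit\<close>, \<open>orbit_if_expansion\<close>).  Staying there already forces
  \<open>X n \<ge> a\<^sub>1\<close> at a digit \<open>1\<close> and \<open>X n \<le> b\<^sub>0\<close> at a digit \<open>0\<close>.  Hence \<open>w\<close> is greedy iff
  \<open>X n < a\<^sub>1\<close> at every digit \<open>0\<close>, lazy iff \<open>X n > b\<^sub>0\<close> at every digit \<open>1\<close>, and, as the two
  forced inequalities then leave no choice of digit, unique iff it is both
  (\<open>greedy_iff_orbit\<close>, \<open>lazy_iff_orbit\<close>, \<open>unique_iff_greedy_and_lazy\<close>).

  It remains to express \<open>X n < a\<^sub>1\<close> lexicographically.  At a digit \<open>0\<close> it says
  \<open>X (n + 1) < T\<^sub>0 a\<^sub>1 = \<beta>\<^sub>0 / \<beta>\<^sub>1\<close>, a comparison of two points that is to be replaced by one of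
  their digit sequences.  As long as two orbits use the same digits, the same increasing
  expanding map acts on both, so their order persists and their gap grows exponentially
  (\<open>gap_grows\<close>).  Boundedness therefore forces the digits to differ eventually, and the
  thresholds of the two partitions decide which of them is smaller at that place
  (\<open>orbit_less_imp_lex_less\<close>).  Conversely, if the lexicographic condition held but some
  \<open>X n\<close> with digit \<open>0\<close> were \<open>\<ge> a\<^sub>1\<close>, the first difference from \<open>g\<^sup>*(\<beta>\<^sub>0 / \<beta>\<^sub>1)\<close> would be a later
  digit \<open>0\<close> of \<open>w\<close> whose orbit point exceeds \<open>a\<^sub>1\<close> by a larger amount; iterating contradicts
  boundedness (\<open>lex_less_imp_orbit_less\<close>).

  The lazy case is the same argument in a mirror: replacing \<open>X\<close> by \<open>- X\<close> and every digit \<open>d\<close>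
  by \<open>1 - d\<close> reverses both orders and turns lazy into greedy.  For this reason the comparison is
  carried out for arbitrary expanding affine maps \<open>y \<mapsto> r d * y - t d\<close>.
\<close>

section \<open>Orbits of expanding affine maps driven by digits\<close>

definition digit_orbit :: "(nat \<Rightarrow> real) \<Rightarrow> (nat \<Rightarrow> real) \<Rightarrow> (nat \<Rightarrow> nat) \<Rightarrow> (nat \<Rightarrow> real) \<Rightarrow> bool" where
  "digit_orbit r t w X \<longleftrightarrow> (\<forall>n. X (Suc n) = r (w n) * X n - t (w n))"

lemma digit_orbit_Suc: "digit_orbit r t w X \<Longrightarrow> X (Suc n) = r (w n) * X n - t (w n)"
  by (simp add: digit_orbit_def)

lemma digit_orbit_drop: "digit_orbit r t w X \<Longrightarrow> digit_orbit r t (\<lambda>i. w (i + n)) (\<lambda>i. X (i + n))"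
  by (simp add: digit_orbit_def)

lemma shift_funpow: "(shift ^^ n) w = (\<lambda>i. w (i + n))"
  by (induction n arbitrary: w) (simp_all add: shift_def funpow_swap1)

locale expanding_digit_maps =
  fixes r t :: "nat \<Rightarrow> real" and \<rho> :: real
  assumes rate_gt_1: "1 < \<rho>" and rate_le: "\<And>d. \<rho> \<le> r d"
begin

lemma rate_pos: "0 < r d"
  using rate_gt_1 rate_le[of d] by simp

lemma rate_prod_pos: "0 < (\<Prod>j<n. r (w j))"
  by (simp add: prod_pos rate_pos)

text \<open>The remainder after \<open>n\<close> digits of a series expansion is an orbit point divided by the product
  of the rates; this is why bounded orbits give convergent expansions.\<close>

lemma over_rate_prod_tendsto_0:
  assumes "\<And>n. Y n \<in> {0..C}"
  shows "(\<lambda>n. Y n / (\<Prod>j<n. r (w j))) \<longlonglongrightarrow> 0"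
proof -
  have "\<rho> ^ n \<le> (\<Prod>j<n. r (w j))" for n
    using prod_mono[of "{..<n}" "\<lambda>_. \<rho>" "\<lambda>j. r (w j)"] rate_le rate_gt_1 by simp
  then have upper: "Y n / (\<Prod>j<n. r (w j)) \<le> C * (1 / \<rho>) ^ n" for n
    using assms[of n] rate_gt_1 frac_le[of C "Y n" "\<rho> ^ n" "\<Prod>j<n. r (w j)"]
    by (simp add: power_one_over)
  have lower: "0 \<le> Y n / (\<Prod>j<n. r (w j))" for n
    using assms[of n] rate_prod_pos[of w n] by simp
  have "(\<lambda>n. C * (1 / \<rho>) ^ n) \<longlonglongrightarrow> C * 0"
    using rate_gt_1 by (intro tendsto_mult_left LIMSEQ_power_zero) simp
  then have "(\<lambda>n. C * (1 / \<rho>) ^ n) \<longlonglongrightarrow> 0" by (simp only: mult_zero_right)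
  with tendsto_const show ?thesis
    by (rule tendsto_sandwich[rotated 2]) (intro always_eventually allI lower upper)+
qed

text \<open>Under a common digit the difference of two orbits is multiplied by its rate \<open>r d \<ge> \<rho>\<close>;
  the translation parts cancel.\<close>

lemma gap_grows:
  assumes "digit_orbit r t w X" "digit_orbit r t a Z" "X 0 \<le> Z 0" "\<And>i. i < k \<Longrightarrow> w i = a i"
  shows "\<rho> ^ k * (Z 0 - X 0) \<le> Z k - X k"
  using assms(4)
proof (induction k)
  case 0
  show ?case by simp
next
  case (Suc k)
  have IH: "\<rho> ^ k * (Z 0 - X 0) \<le> Z k - X k" using Suc by simp
  have "0 \<le> \<rho> ^ k * (Z 0 - X 0)" using rate_gt_1 assms(3) by simp
  then have "\<rho> * (\<rho> ^ k * (Z 0 - X 0)) \<le> r (w k) * (Z k - X k)"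
    using IH rate_le[of "w k"] rate_gt_1 by (intro mult_mono) auto
  also have "\<dots> = Z (Suc k) - X (Suc k)"
    using digit_orbit_Suc[OF assms(1), of k] digit_orbit_Suc[OF assms(2), of k] Suc.prems[of k]
    by (simp add: algebra_simps)
  finally show ?case by (simp add: mult.assoc)
qed

text \<open>The gap between the two bounded orbits cannot grow forever, so the digits differ somewhere.
  At the first difference the orbit \<open>X\<close> is still below \<open>Z\<close>, so digit \<open>1\<close> for \<open>X\<close> and digit \<open>0\<close>
  for \<open>Z\<close> would give \<open>c \<le> X k < Z k \<le> c\<close>.\<close>

lemma orbit_less_imp_lex_less:
  assumes X: "digit_orbit r t w X" and Z: "digit_orbit r t a Z"
    and w: "range w \<subseteq> {0, 1}" and a: "range a \<subseteq> {0, 1}"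
    and lt: "X 0 < Z 0"
    and Xlow: "\<And>n. B \<le> X n" and Zup: "\<And>n. Z n \<le> C"
    and w1: "\<And>n. w n = 1 \<Longrightarrow> c \<le> X n" and a0: "\<And>n. a n = 0 \<Longrightarrow> Z n \<le> c"
  shows "less_fun w a"
proof -
  have "\<exists>k. w k \<noteq> a k"
  proof (rule ccontr)
    assume "\<nexists>k. w k \<noteq> a k"
    then have "\<rho> ^ k * (Z 0 - X 0) \<le> Z k - X k" for k
      using gap_grows[OF X Z] lt by auto
    then have bound: "\<rho> ^ k * (Z 0 - X 0) \<le> C - B" for k
      using Xlow[of k] Zup[of k] by (smt (verit))
    obtain k where "(C - B) / (Z 0 - X 0) < \<rho> ^ k"
      using real_arch_pow[OF rate_gt_1] by blast
    with bound[of k] lt show False by (simp add: field_simps)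
  qed
  then obtain k where k: "w k \<noteq> a k" and eq: "\<And>i. i < k \<Longrightarrow> w i = a i"
    using exists_least_iff[of "\<lambda>k. w k \<noteq> a k"] by blast
  have "0 < \<rho> ^ k * (Z 0 - X 0)" using lt rate_gt_1 by simp
  then have "X k < Z k" using gap_grows[OF X Z _ eq] lt by force
  then have "\<not> (w k = 1 \<and> a k = 0)" using w1[of k] a0[of k] by (metis leD order_trans)
  moreover have "w k \<in> {0, 1}" "a k \<in> {0, 1}" using w a by auto
  ultimately have "w k = 0 \<and> a k = 1" using k by (metis insertE singletonD)
  then have "w k < a k" by simp
  then show ?thesis using eq by (auto simp: less_fun_def)
qed

text \<open>A violation \<open>c \<le> X n\<close> at a digit \<open>0\<close> reproduces itself: at the first place where the tail of
  \<open>w\<close> falls below \<open>a\<close> there is again a digit \<open>0\<close> of \<open>w\<close>, and there \<open>X\<close> exceeds \<open>c\<close> by more than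
  \<open>\<rho>\<close> times as much.  The resulting sequence of excesses is unbounded.\<close>

lemma lex_less_imp_orbit_less:
  assumes X: "digit_orbit r t w X" and Z: "digit_orbit r t a Z"
    and a: "range a \<subseteq> {0, 1}"
    and Z0: "Z 0 = r 0 * c - t 0"
    and Xup: "\<And>n. X n \<le> C"
    and a1: "\<And>n. a n = 1 \<Longrightarrow> c < Z n"
    and lex: "\<And>n. w n = 0 \<Longrightarrow> less_fun (\<lambda>i. w (i + Suc n)) a"
    and n: "w n = 0"
  shows "X n < c"
proof (rule ccontr)
  have step: "\<exists>m. w m = 0 \<and> \<rho> * (X n - c) < X m - c" if n: "w n = 0" "c \<le> X n" for n
  proof -
    obtain k where k: "w (k + Suc n) < a k" and eq: "\<And>i. i < k \<Longrightarrow> w (i + Suc n) = a i"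
      using lex[OF n(1)] by (auto simp: less_fun_def)
    have "a k \<in> {0, 1}" using a by auto
    with k have digits: "w (k + Suc n) = 0" "a k = 1" by auto
    have gap0: "X (Suc n) - Z 0 = r 0 * (X n - c)"
      using digit_orbit_Suc[OF X, of n] n Z0 by (simp add: algebra_simps)
    have ge: "\<rho> * (X n - c) \<le> r 0 * (X n - c)"
      using rate_le[of 0] n by (intro mult_right_mono) auto
    have nonneg: "0 \<le> \<rho> * (X n - c)" using n rate_gt_1 by simp
    have first: "\<rho> * (X n - c) \<le> X (Suc n) - Z 0" unfolding gap0 by (rule ge)
    have pos: "0 \<le> X (Suc n) - Z 0" using nonneg first by (rule order_trans)
    have pow: "1 \<le> \<rho> ^ k" using rate_gt_1 by simp
    note first
    also have "X (Suc n) - Z 0 \<le> \<rho> ^ k * (X (Suc n) - Z 0)"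
      using mult_right_mono[OF pow pos] by (simp only: mult_1)
    also have "\<dots> \<le> X (k + Suc n) - Z k"
      using gap_grows[OF Z digit_orbit_drop[OF X, of "Suc n"], of k] eq pos by simp
    also have "\<dots> < X (k + Suc n) - c" using a1[OF digits(2)] by simp
    finally show ?thesis using digits(1) by blast
  qed
  assume "\<not> X n < c"
  \<comment> \<open>The excess \<open>X n - c\<close> may be zero; one step makes it positive, so that it can grow.\<close>
  then obtain m where m: "w m = 0" "0 < X m - c"
    using step[OF n] rate_gt_1 by (smt (verit) mult_nonneg_nonneg)
  have grow: "\<exists>l. w l = 0 \<and> \<rho> ^ j * (X m - c) \<le> X l - c" for j
  proof (induction j)
    case 0
    then show ?case using m by auto
  next
    case (Suc j)
    then obtain l where l: "w l = 0" "\<rho> ^ j * (X m - c) \<le> X l - c" by blast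
    have "0 \<le> \<rho> ^ j * (X m - c)" using m rate_gt_1 by simp
    then obtain q where q: "w q = 0" "\<rho> * (X l - c) < X q - c"
      using step[OF l(1)] l(2) by fastforce
    have "\<rho> * (\<rho> ^ j * (X m - c)) \<le> \<rho> * (X l - c)"
      using l(2) rate_gt_1 by (intro mult_left_mono) auto
    then show ?case using q by (intro exI[of _ q]) (simp add: mult.assoc)
  qed
  obtain j where "(C - c) / (X m - c) < \<rho> ^ j"
    using real_arch_pow[OF rate_gt_1] by blast
  then have "C - c < \<rho> ^ j * (X m - c)" using m by (simp add: field_simps)
  then show False using grow[of j] Xup by (smt (verit))
qed

text \<open>The reference orbit \<open>Z\<close> starts at the image of the threshold \<open>c\<close> under the map of digit \<open>0\<close>.
  The point \<open>c\<close> itself gets digit \<open>0\<close> in the sequence \<open>a\<close> but digit \<open>1\<close> in a sequence \<open>w\<close> with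
  the property on the left: this shift of the threshold, the difference between quasi-greedy and
  greedy, is what decides the first differing digit in both directions.
\<close>

lemma lex_criterion:
  assumes X: "digit_orbit r t w X" and Z: "digit_orbit r t a Z"
    and w: "range w \<subseteq> {0, 1}" and a: "range a \<subseteq> {0, 1}"
    and Z0: "Z 0 = r 0 * c - t 0"
    and Xbd: "\<And>n. X n \<in> {B..C}" and Zbd: "\<And>n. Z n \<in> {B..C}"
    and w1: "\<And>n. w n = 1 \<Longrightarrow> c \<le> X n"
    and a_iff: "\<And>n. a n = 0 \<longleftrightarrow> Z n \<le> c"
  shows "(\<forall>n. w n = 0 \<longrightarrow> X n < c) \<longleftrightarrow> (\<forall>n. w n = 0 \<longrightarrow> less_fun (\<lambda>i. w (i + Suc n)) a)"
proof (intro iffI allI impI)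
  fix n assume *: "\<forall>n. w n = 0 \<longrightarrow> X n < c" "w n = 0"
  have "0 < r 0" using rate_le[of 0] rate_gt_1 by simp
  then have "X (Suc n) < Z 0"
    using digit_orbit_Suc[OF X, of n] * Z0 by simp
  then have less0: "X (0 + Suc n) < Z 0" by simp
  have "range (\<lambda>i. w (i + Suc n)) \<subseteq> {0, 1}" using w by (simp add: image_subset_iff)
  then show "less_fun (\<lambda>i. w (i + Suc n)) a"
  proof (rule orbit_less_imp_lex_less[OF digit_orbit_drop[OF X] Z _ a less0])
    show "B \<le> X (i + Suc n)" "Z i \<le> C" for i
      using Xbd[of "i + Suc n"] Zbd[of i] by simp_all
    show "c \<le> X (i + Suc n)" if "w (i + Suc n) = 1" for i using w1[OF that] .
    show "Z i \<le> c" if "a i = 0" for i using a_iff[of i] that by simp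
  qed
next
  fix n assume *: "\<forall>n. w n = 0 \<longrightarrow> less_fun (\<lambda>i. w (i + Suc n)) a" "w n = 0"
  show "X n < c"
  proof (rule lex_less_imp_orbit_less[OF X Z a Z0])
    show "X i \<le> C" for i using Xbd[of i] by simp
    show "c < Z i" if "a i = 1" for i using a_iff[of i] that by simp
  qed (use * in simp_all)
qed

end

section \<open>Exchanging the two digits\<close>

lemma less_fun_flip:
  fixes u v :: "nat \<Rightarrow> nat"
  assumes "range u \<subseteq> {0, 1}" "range v \<subseteq> {0, 1}"
  shows "less_fun (\<lambda>i. 1 - u i) (\<lambda>i. 1 - v i) \<longleftrightarrow> less_fun v u"
proof -
  have "u i \<in> {0, 1}" "v i \<in> {0, 1}" for i using assms by auto
  then have "1 - u i < 1 - v i \<longleftrightarrow> v i < u i" "1 - u i = 1 - v i \<longleftrightarrow> v i = u i" for i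
    by (metis (no_types, opaque_lifting) diff_self_eq_0 diff_zero insert_iff less_irrefl singletonD zero_less_one zero_neq_one not_less_zero)+
  then show ?thesis by (simp add: less_fun_def)
qed

text \<open>For rates \<open>\<beta>\<^sub>0, \<beta>\<^sub>1\<close> this conjugation by \<open>X \<mapsto> - X\<close> carries the quasi-lazy partition, whose
  threshold belongs to piece \<open>1\<close>, to one of quasi-greedy type.\<close>

lemma digit_orbit_flip:
  assumes "digit_orbit r t w X" "range w \<subseteq> {0, 1}"
  shows "digit_orbit (\<lambda>d. r (1 - d)) (\<lambda>d. - t (1 - d)) (\<lambda>i. 1 - w i) (\<lambda>i. - X i)"
proof -
  have "1 - (1 - w n) = w n" for n using assms(2) by (auto dest!: range_subsetD[of w _ n])
  then show ?thesis using assms(1) by (simp add: digit_orbit_def)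
qed

section \<open>Expansions as bounded orbits\<close>

locale two_bases =
  fixes \<beta>\<^sub>0 \<beta>\<^sub>1 :: real
  assumes b0: "\<beta>\<^sub>0 \<in> {1<..2}" and b1: "\<beta>\<^sub>1 \<in> {1<..2}"
begin

text \<open>
  In the usual notation \<open>top_pt\<close> is \<open>b\<^sub>1\<close>, and \<open>[switch_lo, switch_hi]\<close> is the switch region
  \<open>[a\<^sub>1, b\<^sub>0]\<close>, the set of points which both maps keep inside \<open>[0, b\<^sub>1]\<close>.
\<close>

abbreviation "r \<equiv> base \<beta>\<^sub>0 \<beta>\<^sub>1"
abbreviation "top_pt \<equiv> 1 / (\<beta>\<^sub>1 - 1)"
abbreviation "switch_lo \<equiv> 1 / \<beta>\<^sub>1"
abbreviation "switch_hi \<equiv> 1 / (\<beta>\<^sub>0 * (\<beta>\<^sub>1 - 1))"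

sublocale expanding_digit_maps r real "min \<beta>\<^sub>0 \<beta>\<^sub>1"
  using b0 b1 by unfold_locales (auto simp: base_def)

sublocale flip: expanding_digit_maps "\<lambda>d. r (1 - d)" "\<lambda>d. - real (1 - d)" "min \<beta>\<^sub>0 \<beta>\<^sub>1"
  using b0 b1 by unfold_locales (auto simp: base_def)

lemma base_simps [simp]: "r 0 = \<beta>\<^sub>0" "r (Suc 0) = \<beta>\<^sub>1"
  by (simp_all add: base_def)

lemma switch_lo_le_switch_hi: "switch_lo \<le> switch_hi"
proof -
  \<comment> \<open>Cleared of denominators, the claim is \<open>(\<beta>\<^sub>0 - 1) (\<beta>\<^sub>1 - 1) \<le> 1\<close>; here both bases must be at most 2.\<close>
  have "(\<beta>\<^sub>0 - 1) * (\<beta>\<^sub>1 - 1) \<le> 1 * 1" using b0 b1 by (intro mult_mono) auto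
  then show ?thesis using b0 b1 by (simp add: field_simps)
qed

lemma step_0_bounds: "\<beta>\<^sub>0 * y \<in> {0..top_pt} \<longleftrightarrow> y \<in> {0..switch_hi}"
  using b0 b1 by (auto simp: field_simps zero_le_mult_iff)

lemma step_1_bounds: "\<beta>\<^sub>1 * y - 1 \<in> {0..top_pt} \<longleftrightarrow> y \<in> {switch_lo..top_pt}"
proof -
  have "\<beta>\<^sub>1 * y - 1 \<le> top_pt \<longleftrightarrow> \<beta>\<^sub>1 * y \<le> \<beta>\<^sub>1 * top_pt"
    using b1 by (auto simp: field_simps)
  also have "\<dots> \<longleftrightarrow> y \<le> top_pt" using b1 by (intro mult_le_cancel_left_pos) simp
  finally show ?thesis using b1 by (auto simp: field_simps)
qed

text \<open>Unrolling the recursion \<open>n\<close> times writes \<open>X 0\<close> as the \<open>n\<close>-th partial sum plus a remainder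
  that tends to \<open>0\<close>.\<close>

lemma expansion_if_orbit:
  assumes w: "range w \<subseteq> {0, 1}" and X: "digit_orbit r real w X" and bd: "\<And>n. X n \<in> {0..top_pt}"
  shows "is_expansion \<beta>\<^sub>0 \<beta>\<^sub>1 (X 0) w"
proof -
  let ?P = "\<lambda>n. \<Prod>j<n. r (w j)"
  let ?S = "\<lambda>n. \<Sum>i<n. real (w i) / ?P (Suc i)"
  have S: "?S n = X 0 - X n / ?P n" for n
  proof (induction n)
    case (Suc n)
    have "X (Suc n) / ?P (Suc n) = X n / ?P n - real (w n) / ?P (Suc n)"
      using digit_orbit_Suc[OF X, of n] rate_pos[of "w n"] by (simp add: diff_divide_distrib mult.commute)
    then show ?case using Suc by simp
  qed simp
  have "(\<lambda>n. X n / ?P n) \<longlonglongrightarrow> 0" using bd by (rule over_rate_prod_tendsto_0)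
  then have "?S \<longlonglongrightarrow> X 0 - 0" unfolding S by (intro tendsto_intros)
  then show ?thesis using w by (simp add: is_expansion_def sums_def lessThan_Suc_atMost)
qed

text \<open>The orbit point \<open>X n\<close> is the rescaled remainder of the series.  It lies in \<open>[0, b\<^sub>1]\<close> because
  \<open>x\<close> is squeezed between two monotone sequences with limit \<open>x\<close>: the partial sums increase, and
  the partial sums continued by the all-ones tail (of value \<open>b\<^sub>1\<close>) decrease.\<close>

lemma orbit_if_expansion:
  assumes "is_expansion \<beta>\<^sub>0 \<beta>\<^sub>1 x w"
  obtains X where "digit_orbit r real w X" "X 0 = x" "\<And>n. X n \<in> {0..top_pt}"
proof -
  let ?P = "\<lambda>n. \<Prod>j<n. r (w j)"
  let ?S = "\<lambda>n. \<Sum>i<n. real (w i) / ?P (Suc i)"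
  define X where "X n = ?P n * (x - ?S n)" for n
  have w: "w i = 0 \<or> w i = 1" for i using assms by (auto simp: is_expansion_def)
  have S: "?S \<longlonglongrightarrow> x"
    using assms by (simp add: is_expansion_def sums_def lessThan_Suc_atMost)
  have Ppos: "0 < ?P n" for n by (rule rate_prod_pos)
  have "digit_orbit r real w X"
    using rate_pos Ppos by (auto simp: digit_orbit_def X_def field_simps less_imp_neq[symmetric])
  moreover have "X 0 = x" by (simp add: X_def)
  moreover have "X n \<in> {0..top_pt}" for n
  proof -
    have "incseq ?S" using less_imp_le[OF Ppos[of "Suc _"]] by (intro incseq_SucI) simp
    then have "?S n \<le> x" using S by (rule incseq_le)
    let ?U = "\<lambda>n. ?S n + top_pt / ?P n"
    have "?U (Suc n) \<le> ?U n" for n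
    proof -
      have "(real (w n) + top_pt) / r (w n) \<le> top_pt"
      proof -
        \<comment> \<open>\<open>b\<^sub>1\<close> is the fixed point of \<open>T\<^sub>1\<close>.\<close>
        have "0 < top_pt" and top_fixed: "1 + top_pt = top_pt * \<beta>\<^sub>1"
          using b1 by (simp_all add: field_simps)
        then have "top_pt \<le> top_pt * \<beta>\<^sub>0" using b0 by (simp only: mult_le_cancel_left1) simp
        then have "real (w n) + top_pt \<le> top_pt * r (w n)"
          using w[of n] top_fixed by (metis add_0 base_simps(1) base_simps(2) One_nat_def of_nat_0 of_nat_1 order_refl)
        then show ?thesis by (simp only: pos_divide_le_eq[OF rate_pos])
      qed
      then have "(real (w n) + top_pt) / r (w n) / ?P n \<le> top_pt / ?P n"
        using Ppos[of n] by (intro divide_right_mono) auto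
      then show ?thesis by (simp add: add_divide_distrib mult.commute)
    qed
    then have "decseq ?U" by (intro decseq_SucI)
    moreover have "?U \<longlonglongrightarrow> x"
    proof -
      have "(\<lambda>n. top_pt / ?P n) \<longlonglongrightarrow> 0"
        using b1 by (intro over_rate_prod_tendsto_0[of "\<lambda>_. top_pt" top_pt]) simp
      from tendsto_add[OF S this] show ?thesis by simp
    qed
    ultimately have "x \<le> ?U n" by (rule decseq_ge)
    then have "x - ?S n \<le> top_pt / ?P n" by linarith
    then have "(x - ?S n) * ?P n \<le> top_pt" by (simp only: pos_le_divide_eq[OF Ppos])
    moreover have "0 \<le> ?P n * (x - ?S n)"
      using \<open>?S n \<le> x\<close> Ppos[of n] by (intro mult_nonneg_nonneg) linarith+
    ultimately show ?thesis unfolding X_def by (simp only: atLeastAtMost_iff mult.commute simp_thms)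
  qed
  ultimately show ?thesis by (rule that)
qed

section \<open>Expansions generated by a partition\<close>

lemma piece_digits_range: "range (piece_digits \<beta>\<^sub>0 \<beta>\<^sub>1 P x) \<subseteq> {0, 1}"
  by (auto simp: piece_digits_def)

lemma piece_map_on_piece:
  "y \<in> P \<Longrightarrow> piece_map \<beta>\<^sub>0 \<beta>\<^sub>1 P y = \<beta>\<^sub>0 * y"
  "y \<notin> P \<Longrightarrow> piece_map \<beta>\<^sub>0 \<beta>\<^sub>1 P y = \<beta>\<^sub>1 * y - 1"
  by (simp_all add: piece_map_def T0_def T1_def)

lemma piece_orbit:
  "digit_orbit r real (piece_digits \<beta>\<^sub>0 \<beta>\<^sub>1 P x) (\<lambda>n. (piece_map \<beta>\<^sub>0 \<beta>\<^sub>1 P ^^ n) x)"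
  by (simp add: digit_orbit_def piece_digits_def piece_map_def T0_def T1_def)

text \<open>All four partitions cut inside the switch region, so that each map is only applied to points
  which it keeps in \<open>[0, b\<^sub>1]\<close>.\<close>

lemma piece_orbit_bounds:
  assumes "{0..<switch_lo} \<subseteq> P" "P \<subseteq> {0..switch_hi}" "x \<in> {0..top_pt}"
  shows "(piece_map \<beta>\<^sub>0 \<beta>\<^sub>1 P ^^ n) x \<in> {0..top_pt}"
proof (induction n)
  case (Suc n)
  let ?y = "(piece_map \<beta>\<^sub>0 \<beta>\<^sub>1 P ^^ n) x"
  show ?case
  proof (cases "?y \<in> P")
    case True
    then have "?y \<in> {0..switch_hi}" using assms(2) by (rule rev_subsetD)
    then have "\<beta>\<^sub>0 * ?y \<in> {0..top_pt}" by (rule step_0_bounds[THEN iffD2])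
    then show ?thesis using True by (simp add: piece_map_on_piece)
  next
    case False
    then have "?y \<in> {switch_lo..top_pt}"
      using assms(1) Suc by (metis atLeastAtMost_iff atLeastLessThan_iff not_le subsetD)
    then have "\<beta>\<^sub>1 * ?y - 1 \<in> {0..top_pt}" by (rule step_1_bounds[THEN iffD2])
    then show ?thesis using False by (simp add: piece_map_on_piece)
  qed
qed (use assms in simp)

lemma piece_expansion:
  assumes "{0..<switch_lo} \<subseteq> P" "P \<subseteq> {0..switch_hi}" "x \<in> {0..top_pt}"
  shows "is_expansion \<beta>\<^sub>0 \<beta>\<^sub>1 x (piece_digits \<beta>\<^sub>0 \<beta>\<^sub>1 P x)"
  using expansion_if_orbit[OF piece_digits_range piece_orbit piece_orbit_bounds[OF assms]] by simp

lemma eq_piece_digits_iff: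
  assumes w: "range w \<subseteq> {0, 1}" and X: "digit_orbit r real w X"
  shows "w = piece_digits \<beta>\<^sub>0 \<beta>\<^sub>1 P (X 0) \<longleftrightarrow> (\<forall>n. w n = 0 \<longleftrightarrow> X n \<in> P)"
proof
  assume eq: "w = piece_digits \<beta>\<^sub>0 \<beta>\<^sub>1 P (X 0)"
  have "(piece_map \<beta>\<^sub>0 \<beta>\<^sub>1 P ^^ n) (X 0) = X n" for n
  proof (induction n)
    case (Suc n)
    then show ?case
      using digit_orbit_Suc[OF X, of n] digit_orbit_Suc[OF piece_orbit[of P "X 0"], of n]
      unfolding eq[symmetric] by simp
  qed simp
  then show "\<forall>n. w n = 0 \<longleftrightarrow> X n \<in> P"
    using eq by (simp add: piece_digits_def fun_eq_iff)
next
  assume iff: "\<forall>n. w n = 0 \<longleftrightarrow> X n \<in> P"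
  have w01: "w n = 0 \<or> w n = 1" for n using w by auto
  have "(piece_map \<beta>\<^sub>0 \<beta>\<^sub>1 P ^^ n) (X 0) = X n" for n
  proof (induction n)
    case (Suc n)
    then show ?case
      using digit_orbit_Suc[OF X, of n] spec[OF iff, of n] w01[of n]
      by (cases "X n \<in> P") (auto simp: piece_map_on_piece)
  qed simp
  then show "w = piece_digits \<beta>\<^sub>0 \<beta>\<^sub>1 P (X 0)"
    using iff w01 by (fastforce simp: piece_digits_def)
qed

section \<open>The three criteria\<close>

context
  fixes w X
  assumes w: "range w \<subseteq> {0, 1}" and X: "digit_orbit r real w X" and bd: "\<And>n. X n \<in> {0..top_pt}"
begin

text \<open>An orbit that stays in \<open>[0, b\<^sub>1]\<close> can use a map only where this map stays inside; outside the
  switch region the digit is thus forced.\<close>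

lemma digit_0_imp: "w n = 0 \<Longrightarrow> X n \<le> switch_hi"
  using bd[of "Suc n"] step_0_bounds[of "X n"] digit_orbit_Suc[OF X, of n] by simp

lemma digit_1_imp: "w n = 1 \<Longrightarrow> switch_lo \<le> X n"
  using bd[of "Suc n"] step_1_bounds[of "X n"] digit_orbit_Suc[OF X, of n] by simp

lemma digit_cases: "w n = 0 \<or> w n = 1"
  using w by auto

lemma greedy_iff_orbit: "w = greedy_expansion \<beta>\<^sub>0 \<beta>\<^sub>1 (X 0) \<longleftrightarrow> (\<forall>n. w n = 0 \<longrightarrow> X n < switch_lo)"
proof -
  have "(w n = 0 \<longleftrightarrow> X n \<in> {0..<switch_lo}) \<longleftrightarrow> (w n = 0 \<longrightarrow> X n < switch_lo)" for n
    using bd[of n] digit_cases[of n] digit_1_imp[of n] by auto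
  then show ?thesis unfolding greedy_expansion_def eq_piece_digits_iff[OF w X] by blast
qed

lemma lazy_iff_orbit: "w = lazy_expansion \<beta>\<^sub>0 \<beta>\<^sub>1 (X 0) \<longleftrightarrow> (\<forall>n. w n = 1 \<longrightarrow> switch_hi < X n)"
proof -
  have "(w n = 0 \<longleftrightarrow> X n \<in> {0..switch_hi}) \<longleftrightarrow> (w n = 1 \<longrightarrow> switch_hi < X n)" for n
    using bd[of n] digit_cases[of n] digit_0_imp[of n]
    unfolding atLeastAtMost_iff by (metis not_le zero_neq_one)
  then show ?thesis unfolding lazy_expansion_def eq_piece_digits_iff[OF w X] by blast
qed

text \<open>The threshold is \<open>c = a\<^sub>1\<close> with image \<open>T\<^sub>0 a\<^sub>1 = \<beta>\<^sub>0 / \<beta>\<^sub>1\<close>, and the reference orbit is the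
  quasi-greedy one of this image.\<close>

lemma greedy_iff_lex:
  "w = greedy_expansion \<beta>\<^sub>0 \<beta>\<^sub>1 (X 0) \<longleftrightarrow>
    (\<forall>n. w n = 0 \<longrightarrow> less_fun ((shift ^^ Suc n) w) (quasi_greedy_expansion \<beta>\<^sub>0 \<beta>\<^sub>1 (\<beta>\<^sub>0 / \<beta>\<^sub>1)))"
proof -
  let ?P = "{0..switch_lo}" and ?z = "\<beta>\<^sub>0 / \<beta>\<^sub>1"
  let ?Z = "\<lambda>n. (piece_map \<beta>\<^sub>0 \<beta>\<^sub>1 ?P ^^ n) ?z"
  have "?z \<in> {0..top_pt}"
    using step_0_bounds[of switch_lo] switch_lo_le_switch_hi b1 by simp
  then have Zbd: "?Z n \<in> {0..top_pt}" for n
    using switch_lo_le_switch_hi by (intro piece_orbit_bounds) auto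
  have "(\<forall>n. w n = 0 \<longrightarrow> X n < switch_lo) \<longleftrightarrow>
      (\<forall>n. w n = 0 \<longrightarrow> less_fun (\<lambda>i. w (i + Suc n)) (piece_digits \<beta>\<^sub>0 \<beta>\<^sub>1 ?P ?z))"
  proof (rule lex_criterion[OF X piece_orbit w piece_digits_range _ bd Zbd])
    show "piece_digits \<beta>\<^sub>0 \<beta>\<^sub>1 ?P ?z n = 0 \<longleftrightarrow> ?Z n \<le> switch_lo" for n
      using Zbd[of n] by (simp add: piece_digits_def)
  qed (simp_all add: digit_1_imp)
  then show ?thesis
    unfolding greedy_iff_orbit quasi_greedy_expansion_def shift_funpow .
qed

text \<open>After the flip the threshold is \<open>c = - b\<^sub>0\<close>; the map of the flipped digit \<open>0\<close> is the conjugate of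
  \<open>T\<^sub>1\<close>, so the reference orbit starts at \<open>- T\<^sub>1 b\<^sub>0\<close>.\<close>

lemma lazy_iff_lex:
  "w = lazy_expansion \<beta>\<^sub>0 \<beta>\<^sub>1 (X 0) \<longleftrightarrow>
    (\<forall>n. w n = 1 \<longrightarrow>
      less_fun (quasi_lazy_expansion \<beta>\<^sub>0 \<beta>\<^sub>1 (\<beta>\<^sub>1 / (\<beta>\<^sub>0 * (\<beta>\<^sub>1 - 1)) - 1)) ((shift ^^ Suc n) w))"
proof -
  let ?P = "{0..<switch_hi}" and ?z = "\<beta>\<^sub>1 / (\<beta>\<^sub>0 * (\<beta>\<^sub>1 - 1)) - 1"
  let ?Z = "\<lambda>n. (piece_map \<beta>\<^sub>0 \<beta>\<^sub>1 ?P ^^ n) ?z"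
  let ?a = "piece_digits \<beta>\<^sub>0 \<beta>\<^sub>1 ?P ?z"
  have "switch_hi \<le> top_pt"
    using b0 b1 mult_right_mono[of 1 \<beta>\<^sub>0 "\<beta>\<^sub>1 - 1"] by (intro frac_le) simp_all
  then have "?z \<in> {0..top_pt}"
    using step_1_bounds[of switch_hi] switch_lo_le_switch_hi by simp
  then have Zbd: "?Z n \<in> {0..top_pt}" for n
    using switch_lo_le_switch_hi by (intro piece_orbit_bounds) auto
  have flip_0: "1 - w n = 0 \<longleftrightarrow> w n = 1" for n using digit_cases[of n] by auto
  have "(\<forall>n. 1 - w n = 0 \<longrightarrow> - X n < - switch_hi) \<longleftrightarrow>
      (\<forall>n. 1 - w n = 0 \<longrightarrow> less_fun (\<lambda>i. 1 - w (i + Suc n)) (\<lambda>i. 1 - ?a i))"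
  proof (rule flip.lex_criterion[OF digit_orbit_flip[OF X w] digit_orbit_flip[OF piece_orbit piece_digits_range]])
    show "- ?Z 0 = r (1 - 0) * - switch_hi - - real (1 - 0)" by simp
    show "- X n \<in> {- top_pt..0}" "- ?Z n \<in> {- top_pt..0}" for n
      using bd[of n] Zbd[of n] by auto
    show "- switch_hi \<le> - X n" if "1 - w n = 1" for n
      using that digit_0_imp[of n] by simp
    show "1 - ?a n = 0 \<longleftrightarrow> - ?Z n \<le> - switch_hi" for n
      using Zbd[of n] by (simp add: piece_digits_def not_less)
  qed auto
  moreover have "less_fun (\<lambda>i. 1 - w (i + Suc n)) (\<lambda>i. 1 - ?a i) \<longleftrightarrow> less_fun ?a (\<lambda>i. w (i + Suc n))" for n
    using w by (intro less_fun_flip piece_digits_range) (simp add: image_subset_iff)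
  ultimately show ?thesis
    unfolding lazy_iff_orbit quasi_lazy_expansion_def shift_funpow flip_0 by simp
qed

text \<open>If \<open>w\<close> is both greedy and lazy, its orbit avoids the switch region altogether, so every expansion
  of the same point is forced to the same digits.\<close>

lemma unique_iff_greedy_and_lazy:
  "is_unique_expansion \<beta>\<^sub>0 \<beta>\<^sub>1 (X 0) w \<longleftrightarrow>
    w = greedy_expansion \<beta>\<^sub>0 \<beta>\<^sub>1 (X 0) \<and> w = lazy_expansion \<beta>\<^sub>0 \<beta>\<^sub>1 (X 0)"
proof
  assume "is_unique_expansion \<beta>\<^sub>0 \<beta>\<^sub>1 (X 0) w"
  moreover have "is_expansion \<beta>\<^sub>0 \<beta>\<^sub>1 (X 0) (greedy_expansion \<beta>\<^sub>0 \<beta>\<^sub>1 (X 0))"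
    "is_expansion \<beta>\<^sub>0 \<beta>\<^sub>1 (X 0) (lazy_expansion \<beta>\<^sub>0 \<beta>\<^sub>1 (X 0))"
    unfolding greedy_expansion_def lazy_expansion_def
    using switch_lo_le_switch_hi by (auto intro!: piece_expansion bd)
  ultimately show "w = greedy_expansion \<beta>\<^sub>0 \<beta>\<^sub>1 (X 0) \<and> w = lazy_expansion \<beta>\<^sub>0 \<beta>\<^sub>1 (X 0)"
    unfolding is_unique_expansion_def by metis
next
  assume "w = greedy_expansion \<beta>\<^sub>0 \<beta>\<^sub>1 (X 0) \<and> w = lazy_expansion \<beta>\<^sub>0 \<beta>\<^sub>1 (X 0)"
  then have lo: "w n = 0 \<Longrightarrow> X n < switch_lo" and hi: "w n = 1 \<Longrightarrow> switch_hi < X n" for n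
    using greedy_iff_orbit lazy_iff_orbit by blast+
  have "v = w" if v: "is_expansion \<beta>\<^sub>0 \<beta>\<^sub>1 (X 0) v" for v
  proof -
    obtain Y where Y: "digit_orbit r real v Y" "Y 0 = X 0" "\<And>n. Y n \<in> {0..top_pt}"
      using orbit_if_expansion[OF v] by blast
    have v01: "v n = 0 \<or> v n = 1" for n using v by (auto simp: is_expansion_def)
    have digit: "v n = w n" if "Y n = X n" for n
    proof -
      have "v n = 0 \<Longrightarrow> X n \<le> switch_hi"
        using Y(3)[of "Suc n"] step_0_bounds[of "Y n"] digit_orbit_Suc[OF Y(1), of n] that by simp
      moreover have "v n = 1 \<Longrightarrow> switch_lo \<le> X n"
        using Y(3)[of "Suc n"] step_1_bounds[of "Y n"] digit_orbit_Suc[OF Y(1), of n] that by simp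
      ultimately show ?thesis
        using v01[of n] digit_cases[of n] lo[of n] hi[of n] by linarith
    qed
    have "Y n = X n" for n
    proof (induction n)
      case (Suc n)
      then show ?case
        using digit[of n] digit_orbit_Suc[OF X, of n] digit_orbit_Suc[OF Y(1), of n] by simp
    qed (rule Y(2))
    then show ?thesis using digit by blast
  qed
  then show "is_unique_expansion \<beta>\<^sub>0 \<beta>\<^sub>1 (X 0) w"
    unfolding is_unique_expansion_def using expansion_if_orbit[OF w X bd] by blast
qed

end

end

theorem corollary1p4:
  fixes \<beta>\<^sub>0 \<beta>\<^sub>1 x :: real and w :: "nat \<Rightarrow> nat"
  assumes "\<beta>\<^sub>0 \<in> {1<..2}" and "\<beta>\<^sub>1 \<in> {1<..2}"
    and "x \<in> {0..1 / (\<beta>\<^sub>1 - 1)}"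
    and "is_expansion \<beta>\<^sub>0 \<beta>\<^sub>1 x w"
  shows "(w = greedy_expansion \<beta>\<^sub>0 \<beta>\<^sub>1 x \<longleftrightarrow>
           (\<forall>n\<ge>1. w (n - 1) = 0 \<longrightarrow>
              less_fun ((shift ^^ n) w) (quasi_greedy_expansion \<beta>\<^sub>0 \<beta>\<^sub>1 (\<beta>\<^sub>0 / \<beta>\<^sub>1))))
       \<and> (w = lazy_expansion \<beta>\<^sub>0 \<beta>\<^sub>1 x \<longleftrightarrow>
           (\<forall>n\<ge>1. w (n - 1) = 1 \<longrightarrow>
              less_fun (quasi_lazy_expansion \<beta>\<^sub>0 \<beta>\<^sub>1 (\<beta>\<^sub>1 / (\<beta>\<^sub>0 * (\<beta>\<^sub>1 - 1)) - 1)) ((shift ^^ n) w)))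
       \<and> (is_unique_expansion \<beta>\<^sub>0 \<beta>\<^sub>1 x w \<longleftrightarrow>
           (\<forall>n\<ge>1. w (n - 1) = 0 \<longrightarrow>
              less_fun ((shift ^^ n) w) (quasi_greedy_expansion \<beta>\<^sub>0 \<beta>\<^sub>1 (\<beta>\<^sub>0 / \<beta>\<^sub>1)))
         \<and> (\<forall>n\<ge>1. w (n - 1) = 1 \<longrightarrow>
              less_fun (quasi_lazy_expansion \<beta>\<^sub>0 \<beta>\<^sub>1 (\<beta>\<^sub>1 / (\<beta>\<^sub>0 * (\<beta>\<^sub>1 - 1)) - 1)) ((shift ^^ n) w)))"
proof -
  interpret two_bases \<beta>\<^sub>0 \<beta>\<^sub>1 using assms by unfold_locales
  have w: "range w \<subseteq> {0, 1}" using assms(4) by (simp add: is_expansion_def)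
  obtain X where X: "digit_orbit (base \<beta>\<^sub>0 \<beta>\<^sub>1) real w X" and X0: "X 0 = x"
    and bd: "\<And>n. X n \<in> {0..1 / (\<beta>\<^sub>1 - 1)}"
    using orbit_if_expansion[OF assms(4)] by blast
  \<comment> \<open>The \<open>n\<close>-th digit, counted from 1, is \<open>w (n - 1)\<close>, and its tail is \<open>\<sigma>\<^sup>n w\<close>.\<close>
  have from_1: "(\<forall>n\<ge>1. Q (n - 1) n) \<longleftrightarrow> (\<forall>n. Q n (Suc n))" for Q :: "nat \<Rightarrow> nat \<Rightarrow> bool"
  proof (intro iffI allI impI)
    fix n assume "\<forall>n\<ge>1. Q (n - 1) n"
    from this[rule_format, of "Suc n"] show "Q n (Suc n)" by simp
  next
    fix n :: nat assume "\<forall>n. Q n (Suc n)" "1 \<le> n"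
    from this(1)[rule_format, of "n - 1"] this(2) show "Q (n - 1) n" by simp
  qed
  note greedy = greedy_iff_lex[OF w X bd, unfolded X0]
  note lazy = lazy_iff_lex[OF w X bd, unfolded X0]
  note unique = unique_iff_greedy_and_lazy[OF w X bd, unfolded X0]
  note count_0 = from_1[of "\<lambda>i n. w i = 0 \<longrightarrow> less_fun ((shift ^^ n) w) (quasi_greedy_expansion \<beta>\<^sub>0 \<beta>\<^sub>1 (\<beta>\<^sub>0 / \<beta>\<^sub>1))"]
  note count_1 = from_1[of "\<lambda>i n. w i = 1 \<longrightarrow>
    less_fun (quasi_lazy_expansion \<beta>\<^sub>0 \<beta>\<^sub>1 (\<beta>\<^sub>1 / (\<beta>\<^sub>0 * (\<beta>\<^sub>1 - 1)) - 1)) ((shift ^^ n) w)"]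
  show ?thesis by (simp only: unique greedy lazy count_0 count_1 simp_thms)
qed

end
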